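(* Let $V$ be a valuation domain with quotient field $K$ and valuation $v$, and let $E=\{s_\nu\}_{\nu\in\Lambda},F=\{t_\mu\}_{\mu\in\Lambda}\subset K$ be pseudo-convergent sequences. Then $E$ and $F$ are equivalent (i.e. $V_E=V_F$) if and only if $\mathrm{Br}(E)=\mathrm{Br}(F)$ and, for every $\kappa\in\Lambda$, there are $\nu_0,\mu_0\in\Lambda$ such that, whenever $\nu\geq\nu_0$, $\mu\geq\mu_0$, we have $v(s_\nu-t_\mu)>v(t_\rho-t_\kappa)$ for any $\rho>\kappa$.
   Context: $\Lambda$ is a well-ordered set without maximum. A sequence $E=\{s_\nu\}_{\nu\in\Lambda}\subset K$ is pseudo-convergent if $v(s_\rho-s_\nu)<v(s_\sigma-s_\rho)$ for all $\nu<\rho<\sigma$ in $\Lambda$. Its gauge is $\delta_\nu=v(s_\rho-s_\nu)$ for any $\rho>\nu$ (independent of $\rho$), and its breadth ideal is $\mathrm{Br}(E)=\{x\in K\mid v(x)>\delta_\nu\text{ for all }\nu\in\Lambda\}$. Put $V_E=\{\phi\in K(X)\mid \phi(s_\nu)\in V\text{ for all sufficiently large }\nu\in\Lambda\}$, a valuation domain of $K(X)$ extending $V$. $E$ and $F$ are called equivalent if $V_E=V_F$. *)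

theory Defs
  imports
    "HOL-Computational_Algebra.Computational_Algebra"
    "HOL-Library.Lattice_Constructions"
begin

section \<open>Valuation domains and their valuations\<close>

text \<open>
  The ambient field \<open>K\<close> is the type \<open>'k\<close>; a valuation domain with quotient field \<open>K\<close> is a
  subring \<open>V\<close> of \<open>K\<close> containing \<open>x\<close> or its inverse for every \<open>x\<close> in \<open>K\<close>.
  (For \<open>x = 0\<close> the last clause holds trivially since \<open>V\<close> contains \<open>0\<close>.)
\<close>

definition valuation_domain :: "'k::field set \<Rightarrow> bool" where
  "valuation_domain V \<longleftrightarrow>
     0 \<in> V \<and> 1 \<in> V \<and>
     (\<forall>x\<in>V. \<forall>y\<in>V. x - y \<in> V \<and> x * y \<in> V) \<and>
     (\<forall>x. x \<in> V \<or> inverse x \<in> V)"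

text \<open>
  Values lie in \<open>\<Gamma> \<union> {\<infinity>}\<close>, where \<open>\<Gamma>\<close> is a linearly ordered abelian group \<open>'g\<close> and the infinite
  value is \<open>top.Top\<close>. The library already provides the order on \<open>'g top\<close>.
\<close>

instantiation top :: (plus) plus
begin

definition plus_top :: "'a top \<Rightarrow> 'a top \<Rightarrow> 'a top" where
  "plus_top x y = (case (x, y) of (top.Value a, top.Value b) \<Rightarrow> top.Value (a + b) | _ \<Rightarrow> top.Top)"

instance ..

end

text \<open>
  \<open>\<Gamma>\<close> may be larger than the value group of \<open>v\<close>: surjectivity onto \<open>\<Gamma>\<close> is not required.
\<close>

definition valuation :: "('k::field \<Rightarrow> 'g::linordered_ab_group_add top) \<Rightarrow> bool" where
  "valuation v \<longleftrightarrow>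
     (\<forall>x. v x = top.Top \<longleftrightarrow> x = 0) \<and>
     (\<forall>x y. v (x * y) = v x + v y) \<and>
     (\<forall>x y. min (v x) (v y) \<le> v (x + y))"

definition valuation_of :: "'k::field set \<Rightarrow> ('k \<Rightarrow> 'g::linordered_ab_group_add top) \<Rightarrow> bool" where
  "valuation_of V v \<longleftrightarrow> valuation v \<and> V = {x. top.Value 0 \<le> v x}"


section \<open>Pseudo-convergent sequences\<close>

text \<open>
  The index set \<open>\<Lambda>\<close> is the type \<open>'l\<close>: class \<^class>\<open>wellorder\<close> makes it well-ordered, class
  \<^class>\<open>no_top\<close> excludes a maximum.
\<close>

definition pseudo_convergent ::
  "('k::field \<Rightarrow> 'g::linordered_ab_group_add top) \<Rightarrow> ('l::{wellorder,no_top} \<Rightarrow> 'k) \<Rightarrow> bool" where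
  "pseudo_convergent v s \<longleftrightarrow>
     (\<forall>\<nu> \<rho> \<sigma>. \<nu> < \<rho> \<and> \<rho> < \<sigma> \<longrightarrow> v (s \<rho> - s \<nu>) < v (s \<sigma> - s \<rho>))"

definition gauge ::
  "('k::field \<Rightarrow> 'g::linordered_ab_group_add top) \<Rightarrow> ('l::{wellorder,no_top} \<Rightarrow> 'k) \<Rightarrow> 'l \<Rightarrow> 'g top" where
  "gauge v s \<nu> = (THE \<delta>. \<forall>\<rho>>\<nu>. v (s \<rho> - s \<nu>) = \<delta>)"

definition breadth_ideal ::
  "('k::field \<Rightarrow> 'g::linordered_ab_group_add top) \<Rightarrow> ('l::{wellorder,no_top} \<Rightarrow> 'k) \<Rightarrow> 'k set" where
  "breadth_ideal v s = {x. \<forall>\<nu>. gauge v s \<nu> < v x}"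


section \<open>The valuation domain of rational functions attached to a sequence\<close>

text \<open>
  \<open>K(X)\<close> is the type \<open>'k poly fract\<close>. The value of \<open>\<phi>\<close> at \<open>a\<close> is given as a relation, since
  \<open>\<phi>\<close> has no value at a pole. The representation \<open>p / q\<close> of \<open>\<phi>\<close> need not be in lowest terms:
  any one whose denominator does not vanish at \<open>a\<close> yields the same value.
\<close>

definition has_value_at :: "'k::field poly fract \<Rightarrow> 'k \<Rightarrow> 'k \<Rightarrow> bool" where
  "has_value_at \<phi> a c \<longleftrightarrow>
     (\<exists>p q. \<phi> = Fract p q \<and> poly q a \<noteq> 0 \<and> c = poly p a / poly q a)"

definition V_seq :: "'k::field set \<Rightarrow> ('l::{wellorder,no_top} \<Rightarrow> 'k) \<Rightarrow> 'k poly fract set" where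
  "V_seq V s = {\<phi>. \<forall>\<^sub>F \<nu> in at_top. \<exists>c\<in>V. has_value_at \<phi> (s \<nu>) c}"

definition equivalent_seqs ::
  "'k::field set \<Rightarrow> ('l::{wellorder,no_top} \<Rightarrow> 'k) \<Rightarrow> ('l \<Rightarrow> 'k) \<Rightarrow> bool" where
  "equivalent_seqs V s t \<longleftrightarrow> V_seq V s = V_seq V t"


section \<open>Well-definedness of the gauge and of evaluation\<close>

lemma has_value_at_unique:
  assumes "has_value_at \<phi> a c" and "has_value_at \<phi> a d"
  shows "c = d"
proof -
  from assms obtain p q p' q' where
    eq: "Fract p q = Fract p' q'" and nz: "poly q a \<noteq> 0" "poly q' a \<noteq> 0"
    and c: "c = poly p a / poly q a" and d: "d = poly p' a / poly q' a"
    unfolding has_value_at_def by blast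
  from nz have "q \<noteq> 0" "q' \<noteq> 0" by auto
  with eq have "p * q' = p' * q" by (simp add: eq_fract)
  then have "poly p a * poly q' a = poly p' a * poly q a"
    unfolding poly_mult[symmetric] by simp
  with nz show ?thesis unfolding c d by (simp add: frac_eq_eq)
qed

lemma Value_add_Value [simp]: "top.Value a + top.Value b = top.Value (a + b)"
  and Top_add [simp]: "top.Top + x = top.Top"
  and add_Top [simp]: "x + top.Top = top.Top"
  by (auto simp: plus_top_def split: top.splits)

lemma valuation_minus_one:
  assumes "valuation v" shows "v (- 1) = top.Value 0"
proof -
  have sq: "\<And>x y. v (x * y) = v x + v y" and top: "\<And>x. v x = top.Top \<longleftrightarrow> x = 0"
    using assms by (auto simp: valuation_def)
  obtain a where a: "v 1 = top.Value a" using top[of 1] by (cases "v 1") auto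
  obtain b where b: "v (- 1) = top.Value b" using top[of "- 1"] by (cases "v (- 1)") auto
  have "a = 0" using sq[of 1 1] a by simp
  moreover have "b + b = a" using sq[of "- 1" "- 1"] a b by simp
  ultimately have "b = 0" by simp
  then show ?thesis using b by simp
qed

lemma valuation_uminus:
  assumes "valuation v" shows "v (- x) = v x"
proof -
  have "v (- 1 * x) = v (- 1) + v x"
    using assms unfolding valuation_def by blast
  then have "v (- x) = v (- 1) + v x" by simp
  then show ?thesis using valuation_minus_one[OF assms] by (cases "v x") auto
qed

lemma valuation_add_eq:
  assumes "valuation v" and "v x < v y" shows "v (x + y) = v x"
proof (rule antisym)
  have tri: "min (v a) (v b) \<le> v (a + b)" for a b
    using assms(1) by (auto simp: valuation_def)
  show "v x \<le> v (x + y)"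
    using tri[of x y] less_imp_le[OF assms(2)] by (simp add: min_def)
  have "min (v (x + y)) (v y) \<le> v x"
    using tri[of "x + y" "- y"] valuation_uminus[OF assms(1), of y] by simp
  then show "v (x + y) \<le> v x"
    using assms(2) by (metis min_le_iff_disj not_le)
qed

lemma gauge_eq:
  assumes "valuation v" and "pseudo_convergent v s" and "\<nu> < \<rho>"
  shows "gauge v s \<nu> = v (s \<rho> - s \<nu>)"
proof -
  have step: "v (s \<sigma> - s \<nu>) = v (s \<tau> - s \<nu>)" if "\<nu> < \<tau>" "\<tau> < \<sigma>" for \<sigma> \<tau>
    using valuation_add_eq[OF assms(1), of "s \<tau> - s \<nu>" "s \<sigma> - s \<tau>"] assms(2) that
    by (auto simp: pseudo_convergent_def)
  have eq: "v (s \<sigma> - s \<nu>) = v (s \<rho> - s \<nu>)" if "\<nu> < \<sigma>" for \<sigma>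
    using step[of \<rho> \<sigma>] step[of \<sigma> \<rho>] that assms(3) by (metis linorder_cases)
  show ?thesis
    unfolding gauge_def
  proof (rule the_equality)
    show "\<forall>\<sigma>>\<nu>. v (s \<sigma> - s \<nu>) = v (s \<rho> - s \<nu>)" using eq by blast
    show "\<delta> = v (s \<rho> - s \<nu>)" if "\<forall>\<sigma>>\<nu>. v (s \<sigma> - s \<nu>) = \<delta>" for \<delta>
      using that assms(3) by blast
  qed
qed

end

theory Submission
  imports "HOL-Algebra.Algebraic_Closure_Type" Defs
begin

text \<open>
  If \<open>V\<^sub>E = V\<^sub>F\<close>, both conditions follow by testing membership of \<open>(X - t\<^sub>\<kappa>) / x\<close> for
  suitable \<open>x\<close>. Conversely, extend \<open>V\<close> to a valuation domain \<open>W\<close> of the algebraic closure. The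
  two conditions force, for every \<open>\<alpha>\<close> there, that either \<open>s\<^sub>\<nu> - \<alpha>\<close> and \<open>t\<^sub>\<mu> - \<alpha>\<close> eventually have
  one and the same constant value, or \<open>\<alpha>\<close> is a pseudo-limit of both sequences and the values are the
  gauges. Factoring numerator and denominator, the values of \<open>\<phi>(s\<^sub>\<nu>)\<close> and \<open>\<phi>(t\<^sub>\<mu>)\<close> are given by the
  same expression \<open>\<gamma> + n\<delta>\<close> in the respective gauges \<open>\<delta>\<close>, which are cofinal in each other
  because the breadth ideals agree.
\<close>

subsection \<open>Extending a valuation domain to the algebraic closure\<close>

locale subring_set =
  fixes R :: "'a::comm_ring_1 set"
  assumes zero_mem [simp]: "0 \<in> R"
    and one_mem [simp]: "1 \<in> R"
    and diff_mem: "x \<in> R \<Longrightarrow> y \<in> R \<Longrightarrow> x - y \<in> R"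
    and mult_mem: "x \<in> R \<Longrightarrow> y \<in> R \<Longrightarrow> x * y \<in> R"
begin

lemma uminus_mem: "x \<in> R \<Longrightarrow> - x \<in> R"
  using diff_mem[of 0 x] by simp

lemma add_mem: "x \<in> R \<Longrightarrow> y \<in> R \<Longrightarrow> x + y \<in> R"
  using diff_mem[of x "- y"] uminus_mem by simp

lemma power_mem: "x \<in> R \<Longrightarrow> x ^ n \<in> R"
  by (induction n) (auto intro: mult_mem)

lemma sum_mem: "(\<And>i. i \<in> A \<Longrightarrow> f i \<in> R) \<Longrightarrow> sum f A \<in> R"
  by (induction A rule: infinite_finite_induct) (auto intro: add_mem)

definition polys :: "'a poly set" where
  "polys = {p. \<forall>i. Polynomial.coeff p i \<in> R}"

lemma polysD: "p \<in> polys \<Longrightarrow> Polynomial.coeff p i \<in> R"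
  by (simp add: polys_def)

lemma subring_set_polys: "subring_set polys"
  by unfold_locales
     (auto simp: polys_def coeff_mult coeff_1 intro!: diff_mem sum_mem mult_mem)

lemma const_mem_polys: "c \<in> R \<Longrightarrow> [:c:] \<in> polys"
  by (auto simp: polys_def coeff_pCons split: nat.split)

lemma monom_mem_polys: "c \<in> R \<Longrightarrow> Polynomial.monom c n \<in> polys"
  by (auto simp: polys_def)

lemma smult_mem_polys: "c \<in> R \<Longrightarrow> p \<in> polys \<Longrightarrow> Polynomial.smult c p \<in> polys"
  by (auto simp: polys_def intro: mult_mem)

text \<open>This set is R[x], the image of R[X] under evaluation at \<open>x\<close>.\<close>

lemma subring_set_adjoin: "subring_set ((\<lambda>p. poly p x) ` polys)"
proof -
  interpret P: subring_set polys by (rule subring_set_polys)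
  show ?thesis
  proof
    fix a b assume "a \<in> (\<lambda>p. poly p x) ` polys" "b \<in> (\<lambda>p. poly p x) ` polys"
    then obtain p q where "p \<in> polys" "q \<in> polys" "a = poly p x" "b = poly q x" by auto
    then show "a - b \<in> (\<lambda>p. poly p x) ` polys" "a * b \<in> (\<lambda>p. poly p x) ` polys"
      by (auto intro: image_eqI[of _ _ "p - q"] image_eqI[of _ _ "p * q"] P.diff_mem P.mult_mem)
  qed (auto intro: image_eqI[of _ _ 0] image_eqI[of _ _ 1])
qed

end

lemma valuation_domain_subring_set: "valuation_domain V \<Longrightarrow> subring_set V"
  by unfold_locales (auto simp: valuation_domain_def)

section \<open>Chevalley's argument for a maximal subring with trace V on the base field\<close>

text \<open>In \<open>maximal\<close> only one inclusion is demanded of the trace of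
  \<open>S\<close>, since \<open>R \<subseteq> S\<close> gives the other.\<close>

locale maximal_extension = subring_set R for R :: "'k::field alg_closure set" +
  fixes V :: "'k set"
  assumes valuation_domain: "valuation_domain V"
    and to_ac_mem_iff: "to_ac x \<in> R \<longleftrightarrow> x \<in> V"
    and maximal: "\<And>S. subring_set S \<Longrightarrow> R \<subseteq> S \<Longrightarrow> (\<And>x. to_ac x \<in> S \<Longrightarrow> x \<in> V) \<Longrightarrow> S = R"
begin

lemma inverse_mem: "y \<notin> V \<Longrightarrow> inverse y \<in> V"
  using valuation_domain unfolding valuation_domain_def by blast

text \<open>
  The inverses of the elements outside \<open>V\<close> are the nonzero elements of its maximal ideal \<open>M\<close>.
  As \<open>V\<close> is a valuation domain, every element of \<open>M R\<close> is a multiple of a single element of \<open>M\<close>,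
  so \<open>M R \<noteq> R\<close> amounts to \<open>R \<inter> K = V\<close>.
\<close>

lemma combination_neq_1:
  assumes "y \<notin> V" "z \<notin> V" "a \<in> R" "b \<in> R"
  shows "to_ac (inverse y) * a + to_ac (inverse z) * b \<noteq> 1"
proof -
  have *: False
    if "y \<notin> V" "z \<notin> V" "a \<in> R" "b \<in> R" "to_ac (inverse y) * a + to_ac (inverse z) * b = 1" "y / z \<in> V"
    for y z a b
  proof -
    have [simp]: "y \<noteq> 0" "z \<noteq> 0" using that valuation_domain by (auto simp: valuation_domain_def)
    have "to_ac y = to_ac y * (to_ac (inverse y) * a + to_ac (inverse z) * b)" using that by simp
    also have "\<dots> = a + to_ac (y / z) * b" by (simp add: distrib_left divide_inverse flip: mult.assoc)
    also have "\<dots> \<in> R" using that by (auto intro!: add_mem mult_mem simp: to_ac_mem_iff simp del: to_ac_divide)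
    finally show False using that by (simp add: to_ac_mem_iff)
  qed
  have "y / z \<in> V \<or> z / y \<in> V"
    using inverse_mem[of "y / z"] by auto
  then show ?thesis
    using *[of y z a b] *[of z y b a] assms by (auto simp: add.commute)
qed

text \<open>Adjoining the inverse of \<open>u\<close> brings no new element of the base field into
  the ring, so by maximality the inverse is already in \<open>R\<close>.\<close>

lemma inverse_one_minus_mem:
  assumes "y \<notin> V" "b \<in> R"
  defines "u \<equiv> 1 - to_ac (inverse y) * b"
  shows "u \<noteq> 0" "inverse u \<in> R"
proof -
  show u: "u \<noteq> 0"
    using combination_neq_1[of y y b 0] assms by auto
  have u_mem: "u \<in> R"
    using assms inverse_mem by (auto intro!: diff_mem mult_mem simp: to_ac_mem_iff simp del: to_ac_inverse)
  let ?S = "(\<lambda>p. poly p (inverse u)) ` polys"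
  \<comment> \<open>Multiplication by a power of \<open>u\<close> clears the denominators of an
    element of R[1/u].\<close>
  have clear: "\<exists>n. u ^ n * poly p (inverse u) \<in> R" if "p \<in> polys" for p
  proof
    have "u ^ Polynomial.degree p * poly p (inverse u) = poly (reflect_poly p) u"
      using u by (simp add: poly_reflect_poly_nz)
    also have "\<dots> = (\<Sum>i\<le>Polynomial.degree (reflect_poly p). Polynomial.coeff (reflect_poly p) i * u ^ i)"
      by (simp add: poly_altdef)
    also have "\<dots> \<in> R"
      using that u_mem by (auto intro!: sum_mem mult_mem power_mem simp: coeff_reflect_poly polysD)
    finally show "u ^ Polynomial.degree p * poly p (inverse u) \<in> R" .
  qed
  \<comment> \<open>Powers of \<open>u\<close> stay congruent to 1 modulo the multiples of
    1/y.\<close>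
  have one_minus_power: "\<exists>c\<in>R. 1 - u ^ n = to_ac (inverse y) * c" for n
  proof (induction n)
    case 0
    show ?case by (auto intro: bexI[of _ 0])
  next
    case (Suc n)
    then obtain c where c: "c \<in> R" "1 - u ^ n = to_ac (inverse y) * c" by auto
    have "1 - u ^ Suc n = (1 - u) + u * (1 - u ^ n)" by (simp add: algebra_simps)
    also have "\<dots> = to_ac (inverse y) * (b + u * c)"
      unfolding c(2) by (simp add: u_def algebra_simps)
    finally show ?case using c(1) u_mem assms(2) by (auto intro!: bexI[of _ "b + u * c"] add_mem mult_mem)
  qed
  have "?S = R"
  proof (rule maximal)
    show "subring_set ?S" by (rule subring_set_adjoin)
    show "R \<subseteq> ?S"
    proof
      fix r assume "r \<in> R"
      then show "r \<in> ?S" by (intro image_eqI[of _ _ "[:r:]"]) (auto simp: const_mem_polys)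
    qed
    fix x assume "to_ac x \<in> ?S"
    then obtain p where "p \<in> polys" "to_ac x = poly p (inverse u)" by auto
    then obtain n where n: "u ^ n * to_ac x \<in> R" using clear by metis
    obtain c where c: "c \<in> R" "1 - u ^ n = to_ac (inverse y) * c" using one_minus_power by auto
    show "x \<in> V"
    proof (rule ccontr)
      assume x: "x \<notin> V"
      then have "x \<noteq> 0" using valuation_domain by (auto simp: valuation_domain_def)
      \<comment> \<open>The first summand is \<open>u ^ n\<close>, the second
        \<open>1 - u ^ n\<close>.\<close>
      then have "to_ac (inverse x) * (u ^ n * to_ac x) + to_ac (inverse y) * c = 1"
        unfolding c(2)[symmetric] by simp
      then show False using combination_neq_1[OF x assms(1) n c(1)] by simp
    qed
  qed
  moreover have "inverse u \<in> ?S"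
    by (intro image_eqI[of _ _ "Polynomial.monom 1 1"]) (auto simp: poly_monom monom_mem_polys)
  ultimately show "inverse u \<in> R" by simp
qed

text \<open>Dividing the relation by \<open>y\<close> writes 1 as a polynomial in \<open>x\<close>
  with coefficients in M R, as in Chevalley's extension theorem; \<open>n\<close> bounds its
  degree.\<close>

definition escapes :: "nat \<Rightarrow> 'k alg_closure \<Rightarrow> bool" where
  "escapes n x \<longleftrightarrow> (\<exists>y p. y \<notin> V \<and> p \<in> polys \<and> Polynomial.degree p \<le> n \<and> poly p x = to_ac y)"

lemma not_escapes_0: "\<not> escapes 0 x"
  by (auto simp: escapes_def to_ac_mem_iff elim!: degree_eq_zeroE dest!: polysD[of _ 0])

text \<open>Otherwise R[x] would meet the base field only in \<open>V\<close>, and maximality would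
  put \<open>x\<close> into \<open>R\<close>.\<close>

lemma exists_escapes:
  assumes "x \<notin> R"
  shows "\<exists>n. escapes n x"
proof (rule ccontr)
  assume neg: "\<nexists>n. escapes n x"
  let ?S = "(\<lambda>p. poly p x) ` polys"
  have "?S = R"
  proof (rule maximal)
    show "subring_set ?S" by (rule subring_set_adjoin)
    show "R \<subseteq> ?S"
    proof
      fix r assume "r \<in> R"
      then show "r \<in> ?S" by (intro image_eqI[of _ _ "[:r:]"]) (auto simp: const_mem_polys)
    qed
    show "y \<in> V" if "to_ac y \<in> ?S" for y
      using that neg by (fastforce simp: escapes_def)
  qed
  moreover have "x \<in> ?S"
    by (intro image_eqI[of _ _ "Polynomial.monom 1 1"]) (auto simp: poly_monom monom_mem_polys)
  ultimately show False using assms by simp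
qed

text \<open>
  The relation for \<open>1 / x\<close>, multiplied by \<open>x ^ Suc n\<close>, expresses \<open>x ^ Suc n\<close> by lower powers
  of \<open>x\<close>, since \<open>1 - b / z\<close> is a unit; this eliminates the top coefficient of \<open>p\<close>.
\<close>

lemma escapes_step:
  assumes x: "escapes (Suc n) x" and x': "escapes (Suc k) (inverse x)" and "k \<le> n" "x \<noteq> 0"
  shows "escapes n x"
proof -
  obtain y p where p: "y \<notin> V" "p \<in> polys" "Polynomial.degree p \<le> Suc n" "poly p x = to_ac y"
    using x by (auto simp: escapes_def)
  obtain z q where q: "z \<notin> V" "q \<in> polys" "Polynomial.degree q \<le> Suc k" "poly q (inverse x) = to_ac z"
    using x' by (auto simp: escapes_def)
  obtain b q' where q_eq: "q = pCons b q'" by (cases q)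
  have b: "b \<in> R" using polysD[OF q(2), of 0] by (simp add: q_eq)
  have q': "Polynomial.coeff q' i \<in> R" for i using polysD[OF q(2), of "Suc i"] by (simp add: q_eq)
  have deg_q': "Polynomial.degree q' \<le> k" using q(3) by (auto simp: q_eq split: if_splits)
  define u where "u = 1 - to_ac (inverse z) * b"
  have u: "u \<noteq> 0" "inverse u \<in> R"
    unfolding u_def using inverse_one_minus_mem[OF q(1) b] by auto
  \<comment> \<open>This is X^n q'(1/X): the monomial pads the reflected polynomial so that
    evaluation at \<open>x\<close> yields exactly the factor \<open>x ^ n\<close>.\<close>
  define r where "r = Polynomial.monom 1 (n - Polynomial.degree q') * reflect_poly q'"
  have z: "z \<noteq> 0" using q(1) valuation_domain by (auto simp: valuation_domain_def)
  have r_mem: "r \<in> polys"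
    by (auto simp: polys_def r_def coeff_monom_mult coeff_reflect_poly q')
  have deg_r: "Polynomial.degree r \<le> n"
  proof -
    have "Polynomial.degree r \<le> (n - Polynomial.degree q') + Polynomial.degree q'"
      unfolding r_def using degree_monom_le degree_reflect_poly_le add_mono
      by (intro order.trans[OF degree_mult_le]) blast
    then show ?thesis using deg_q' \<open>k \<le> n\<close> by simp
  qed
  have "poly r x = x ^ n * poly q' (inverse x)"
    using \<open>x \<noteq> 0\<close> deg_q' \<open>k \<le> n\<close>
    by (simp add: r_def poly_monom poly_reflect_poly_nz flip: mult.assoc power_add)
  \<comment> \<open>The relation for 1/x with its constant term \<open>b\<close> moved across, since
    z u = z - b.\<close>
  moreover have "to_ac z * u = inverse x * poly q' (inverse x)"
    using q(4) z by (simp add: q_eq u_def field_simps)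
  ultimately have "to_ac z * (x ^ Suc n * u) = poly r x"
    using \<open>x \<noteq> 0\<close> by (simp add: field_simps)
  then have x_pow: "x ^ Suc n = to_ac (inverse z) * inverse u * poly r x"
    using z u by (simp add: field_simps)
  define a where "a = Polynomial.coeff p (Suc n)"
  define p0 where "p0 = p - Polynomial.monom a (Suc n)"
  define p' where "p' = p0 + Polynomial.smult (a * to_ac (inverse z) * inverse u) r"
  interpret P: subring_set polys by (rule subring_set_polys)
  have a: "a \<in> R" unfolding a_def by (intro polysD p)
  have zR: "to_ac (inverse z) \<in> R" using inverse_mem[OF q(1)] by (simp add: to_ac_mem_iff del: to_ac_inverse)
  have "p' \<in> polys"
    unfolding p'_def p0_def
    by (intro P.add_mem P.diff_mem smult_mem_polys mult_mem a zR u r_mem p monom_mem_polys)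
  moreover have "Polynomial.degree p' \<le> n"
  proof -
    have "Polynomial.coeff p0 i = 0" if "i > n" for i
      using that p(3) by (cases "i = Suc n") (auto simp: p0_def a_def coeff_eq_0)
    then have "Polynomial.degree p0 \<le> n" by (intro degree_le) auto
    then show ?thesis unfolding p'_def using deg_r
      by (intro degree_add_le order.trans[OF degree_smult_le])
  qed
  moreover have "poly p' x = to_ac y"
  proof -
    have "poly p' x = poly p0 x + a * x ^ Suc n"
      unfolding p'_def x_pow by simp
    also have "\<dots> = poly p x" by (simp add: p0_def poly_monom)
    finally show ?thesis using p by simp
  qed
  ultimately show ?thesis unfolding escapes_def using p(1) by blast
qed

text \<open>Descent: of the two relations, one whose bound is not the smaller can be lowered by a
  degree using the other, and bound 0 is impossible.\<close>

lemma not_escapes_both: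
  assumes "x \<noteq> 0"
  shows "\<not> (escapes n x \<and> escapes k (inverse x))"
  using assms
proof (induction "n + k" arbitrary: n k x rule: less_induct)
  case less
  show ?case
  proof (cases n; cases k)
    fix n' k' assume nk: "n = Suc n'" "k = Suc k'"
    show ?thesis
    proof (cases "k' \<le> n'")
      case True
      then show ?thesis using escapes_step[of n' x k'] less.hyps[of n' k x] less.prems nk by auto
    next
      case False
      then show ?thesis using escapes_step[of k' "inverse x" n'] less.hyps[of n k' x] less.prems nk by auto
    qed
  qed (auto simp: not_escapes_0)
qed

lemma valuation_domain_maximal: "valuation_domain R"
  unfolding valuation_domain_def
proof (intro conjI ballI allI)
  fix x
  show "x \<in> R \<or> inverse x \<in> R"
    using exists_escapes[of x] exists_escapes[of "inverse x"] not_escapes_both[of x]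
    by (cases "x = 0") auto
qed (auto intro: diff_mem mult_mem)

end

text \<open>Zorn's lemma, applied to the subrings with trace \<open>V\<close>, yields a maximal one,
  to which Chevalley's argument applies.\<close>

lemma valuation_domain_extension:
  fixes V :: "'k::field set"
  assumes V: "valuation_domain V"
  obtains W :: "'k alg_closure set" where "valuation_domain W" "\<And>x. to_ac x \<in> W \<longleftrightarrow> x \<in> V"
proof -
  interpret V: subring_set V using V by (rule valuation_domain_subring_set)
  let ?\<A> = "{S. subring_set S \<and> to_ac -` S = V}"
  have "to_ac ` V \<in> ?\<A>"
  proof -
    have "subring_set (to_ac ` V)"
      by unfold_locales
         (auto simp: V.diff_mem V.mult_mem simp flip: to_ac_diff to_ac_mult intro: image_eqI[of _ _ 0] image_eqI[of _ _ 1])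
    then show ?thesis by auto
  qed
  moreover have "\<Union>\<C> \<in> ?\<A>" if ne: "\<C> \<noteq> {}" and chain: "subset.chain ?\<A> \<C>" for \<C>
  proof -
    have mem: "subring_set S" "to_ac -` S = V" if "S \<in> \<C>" for S
      using that chain by (auto simp: subset_chain_def)
    \<comment> \<open>Two elements of the union lie in a common member of the chain, which makes the
      union a subring.\<close>
    have pair: "\<exists>S\<in>\<C>. x \<in> S \<and> y \<in> S" if xy: "x \<in> \<Union>\<C>" "y \<in> \<Union>\<C>" for x y
    proof -
      obtain S T where ST: "S \<in> \<C>" "T \<in> \<C>" "x \<in> S" "y \<in> T" using xy by blast
      then have "S \<subseteq> T \<or> T \<subseteq> S"
        using chain unfolding subset_chain_def by blast
      then show ?thesis using ST by blast
    qed
    have "subring_set (\<Union>\<C>)"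
    proof
      show "0 \<in> \<Union>\<C>" "1 \<in> \<Union>\<C>"
        using ne mem(1) subring_set.zero_mem subring_set.one_mem by blast+
      fix x y assume "x \<in> \<Union>\<C>" "y \<in> \<Union>\<C>"
      then obtain S where S: "S \<in> \<C>" "x \<in> S" "y \<in> S" using pair by blast
      then show "x - y \<in> \<Union>\<C>" "x * y \<in> \<Union>\<C>"
        using subring_set.diff_mem[OF mem(1)] subring_set.mult_mem[OF mem(1)] by blast+
    qed
    moreover have "to_ac -` (\<Union>\<C>) = V" using mem(2) ne by blast
    ultimately show ?thesis by blast
  qed
  ultimately obtain W where W: "W \<in> ?\<A>" and max: "\<And>S. S \<in> ?\<A> \<Longrightarrow> W \<subseteq> S \<Longrightarrow> S = W"
    using subset_Zorn_nonempty[of ?\<A>] by auto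
  have "maximal_extension W V"
  proof (intro maximal_extension.intro maximal_extension_axioms.intro)
    fix S assume S: "subring_set S" "W \<subseteq> S" "\<And>x. to_ac x \<in> S \<Longrightarrow> x \<in> V"
    then have "to_ac -` S = V" using W by blast
    then show "S = W" using S max by blast
  qed (use W V in auto)
  then interpret maximal_extension W V .
  show thesis using that valuation_domain_maximal to_ac_mem_iff by blast
qed

subsection \<open>The divisibility order of a valuation domain\<close>

text \<open>
  This is \<open>w x \<le> w y\<close> for the valuation \<open>w\<close> of \<open>W\<close>. Working with divisibility avoids the value
  group of the extension, which is not available as a type.
\<close>

definition vle :: "'a::field set \<Rightarrow> 'a \<Rightarrow> 'a \<Rightarrow> bool" where
  "vle W x y \<longleftrightarrow> (\<exists>w\<in>W. y = x * w)"

text \<open>As divisibility is total, \<open>x \<prec> y\<close>, the failure of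
  \<open>y \<preceq> x\<close>, is strict inequality of values; \<open>\<approx>\<close> is equality
  of values.\<close>

locale valuation_domain_order =
  fixes W :: "'a::field set"
  assumes valuation_domain: "valuation_domain W"
begin

sublocale subring_set W
  using valuation_domain by (rule valuation_domain_subring_set)

abbreviation le (infix \<open>\<preceq>\<close> 50) where "x \<preceq> y \<equiv> vle W x y"
abbreviation lt (infix \<open>\<prec>\<close> 50) where "x \<prec> y \<equiv> \<not> vle W y x"
abbreviation veq (infix \<open>\<approx>\<close> 50) where "x \<approx> y \<equiv> vle W x y \<and> vle W y x"

lemma le_refl [simp]: "x \<preceq> x"
  unfolding vle_def by (auto intro: bexI[of _ 1])

lemma le_zero [simp]: "x \<preceq> 0"
  unfolding vle_def by (auto intro: bexI[of _ 0])

lemma zero_le_iff [simp]: "0 \<preceq> x \<longleftrightarrow> x = 0"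
  unfolding vle_def by (auto intro: exI[of _ 1])

lemma le_trans [trans]: "x \<preceq> y \<Longrightarrow> y \<preceq> z \<Longrightarrow> x \<preceq> z"
  unfolding vle_def by (metis mult_mem mult.assoc)

lemma le_iff_divide: "x \<noteq> 0 \<Longrightarrow> x \<preceq> y \<longleftrightarrow> y / x \<in> W"
  unfolding vle_def by (auto intro!: bexI[of _ "y / x"])

lemma le_total: "x \<preceq> y \<or> y \<preceq> x"
proof (cases "x = 0 \<or> y = 0")
  case False
  then show ?thesis
    using valuation_domain unfolding valuation_domain_def
    by (metis le_iff_divide inverse_divide)
qed auto

lemma le_add: "x \<preceq> y \<Longrightarrow> x \<preceq> z \<Longrightarrow> x \<preceq> y + z"
  unfolding vle_def by (metis add_mem distrib_left)

lemma le_uminus [simp]: "x \<preceq> - y \<longleftrightarrow> x \<preceq> y"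
proof -
  have "x \<preceq> - z" if "x \<preceq> z" for z
    using that uminus_mem unfolding vle_def by (metis minus_mult_right)
  from this[of y] this[of "- y"] show ?thesis by auto
qed

lemma uminus_le [simp]: "- x \<preceq> y \<longleftrightarrow> x \<preceq> y"
proof -
  have "- z \<preceq> y" if "z \<preceq> y" for z
    using that uminus_mem unfolding vle_def by (metis minus_mult_minus)
  from this[of x] this[of "- x"] show ?thesis by auto
qed

lemma le_minus_commute: "x \<preceq> y - z \<longleftrightarrow> x \<preceq> z - y"
  using le_uminus[of x "y - z"] by simp

lemma minus_le_commute: "y - z \<preceq> x \<longleftrightarrow> z - y \<preceq> x"
  using uminus_le[of "y - z" x] by simp

lemma le_diff: "x \<preceq> y \<Longrightarrow> x \<preceq> z \<Longrightarrow> x \<preceq> y - z"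
  using le_add[of x y "- z"] by simp

lemma le_mult: "a \<preceq> b \<Longrightarrow> c \<preceq> d \<Longrightarrow> a * c \<preceq> b * d"
proof -
  assume "a \<preceq> b" "c \<preceq> d"
  then obtain x y where "x \<in> W" "y \<in> W" "b = a * x" "d = c * y" unfolding vle_def by auto
  then show ?thesis unfolding vle_def by (auto intro!: bexI[of _ "x * y"] mult_mem simp: mult_ac)
qed

lemma le_power: "a \<preceq> b \<Longrightarrow> a ^ n \<preceq> b ^ n"
  by (induction n) (auto intro: le_mult)

lemma mult_le_cancel_left: "c \<noteq> 0 \<Longrightarrow> c * a \<preceq> c * b \<longleftrightarrow> a \<preceq> b"
  unfolding vle_def by (auto simp: mult.assoc)

text \<open>Of \<open>y\<close> and \<open>x + y\<close>, one divides the other and hence the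
  difference \<open>x\<close>; it cannot be \<open>y\<close>.\<close>

lemma add_approx: "x \<prec> y \<Longrightarrow> x + y \<approx> x"
proof
  assume "x \<prec> y"
  then have xy: "x \<preceq> y" using le_total by blast
  then show le: "x \<preceq> x + y" by (intro le_add) auto
  show "x + y \<preceq> x"
  proof (rule ccontr)
    assume "\<not> x + y \<preceq> x"
    then obtain "x \<preceq> x + y" "\<not> x + y \<preceq> x" using le by blast
    moreover have "y \<preceq> x \<or> x + y \<preceq> x"
    proof (rule disjE[OF le_total[of y "x + y"]])
      assume "y \<preceq> x + y"
      then have "y \<preceq> (x + y) - y" by (intro le_diff) auto
      then show ?thesis by simp
    next
      assume "x + y \<preceq> y"
      then have "x + y \<preceq> (x + y) - y" by (intro le_diff) auto
      then show ?thesis by simp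
    qed
    ultimately show False using \<open>x \<prec> y\<close> by blast
  qed
qed

lemma le_lt_trans: "x \<preceq> y \<Longrightarrow> y \<prec> z \<Longrightarrow> x \<prec> z"
  and lt_imp_le: "x \<prec> y \<Longrightarrow> x \<preceq> y"
  using le_trans le_total by blast+

lemma lt_nonzero: "x \<prec> y \<Longrightarrow> x \<noteq> 0"
  by auto

end

subsection \<open>Two pseudo-convergent sequences close to each other\<close>

text \<open>The gauges of \<open>s\<close> and \<open>t\<close> are represented by elements \<open>gs \<nu>\<close>, \<open>gt \<nu>\<close> having these values.\<close>

locale close_pseudo_convergent = valuation_domain_order W
  for W :: "'a::alg_closed_field set" +
  fixes s gs t gt :: "'l::{wellorder,no_top} \<Rightarrow> 'a"
  assumes s_gauge: "\<nu> < \<rho> \<Longrightarrow> s \<rho> - s \<nu> \<approx> gs \<nu>"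
    and s_strict: "\<nu> < \<rho> \<Longrightarrow> gs \<nu> \<prec> gs \<rho>"
    and t_gauge: "\<nu> < \<rho> \<Longrightarrow> t \<rho> - t \<nu> \<approx> gt \<nu>"
    and t_strict: "\<nu> < \<rho> \<Longrightarrow> gt \<nu> \<prec> gt \<rho>"
    and s_le_t: "\<exists>\<mu>. gs \<nu> \<preceq> gt \<mu>"
    and t_le_s: "\<exists>\<nu>. gt \<mu> \<preceq> gs \<nu>"
    and close: "\<exists>\<nu>0 \<mu>0. \<forall>\<nu>\<ge>\<nu>0. \<forall>\<mu>\<ge>\<mu>0. gs \<kappa> \<prec> s \<nu> - t \<mu>"
begin

text \<open>The gauges are cofinal in each other, so closeness beyond every
  \<open>gs \<kappa>\<close> is closeness beyond every \<open>gt \<kappa>\<close>.\<close>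

lemma swap: "close_pseudo_convergent W t gt s gs"
proof
  fix \<kappa>
  obtain \<kappa>' where \<kappa>': "gt \<kappa> \<preceq> gs \<kappa>'" using t_le_s by blast
  then show "\<exists>\<nu>0 \<mu>0. \<forall>\<nu>\<ge>\<nu>0. \<forall>\<mu>\<ge>\<mu>0. gt \<kappa> \<prec> t \<nu> - s \<mu>"
    using close[of \<kappa>'] le_lt_trans minus_le_commute by metis
qed (use s_gauge s_strict t_gauge t_strict s_le_t t_le_s in blast)+

lemma gs_nonzero: "gs \<nu> \<noteq> 0"
  using s_strict lt_nonzero gt_ex by metis

lemma gt_nonzero: "gt \<nu> \<noteq> 0"
  using t_strict lt_nonzero gt_ex by metis

lemma gs_mono: "\<nu> \<le> \<rho> \<Longrightarrow> gs \<nu> \<preceq> gs \<rho>"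
  using s_strict lt_imp_le by (cases "\<nu> = \<rho>") (auto simp: less_le)

lemma gt_mono: "\<nu> \<le> \<rho> \<Longrightarrow> gt \<nu> \<preceq> gt \<rho>"
  using t_strict lt_imp_le by (cases "\<nu> = \<rho>") (auto simp: less_le)

lemma eventually_gs_ge: "\<forall>\<^sub>F \<nu> in at_top. gt \<mu> \<preceq> gs \<nu>"
  unfolding eventually_at_top_linorder using t_le_s gs_mono le_trans by metis

lemma eventually_gt_ge: "\<forall>\<^sub>F \<mu> in at_top. gs \<nu> \<preceq> gt \<mu>"
  unfolding eventually_at_top_linorder using s_le_t gt_mono le_trans by metis

lemma diff_approx:
  assumes "x - z \<prec> y - x" shows "y - z \<approx> x - z"
  using add_approx[OF assms] by simp

text \<open>Here \<alpha> is a pseudo-limit: for late \<nu>, the term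
  \<open>s \<nu> - \<alpha>\<close> is negligible against
  \<open>s \<kappa> - s \<nu>\<close>.\<close>

lemma approx_limit:
  assumes "\<And>\<kappa>. \<forall>\<^sub>F \<nu> in at_top. gs \<kappa> \<preceq> s \<nu> - \<alpha>"
  shows "s \<kappa> - \<alpha> \<approx> gs \<kappa>"
proof -
  \<comment> \<open>A later index turns the weak bound of the hypothesis into a strict one at
    \<kappa>.\<close>
  obtain \<kappa>' where \<kappa>': "\<kappa> < \<kappa>'" using gt_ex by blast
  have "\<forall>\<^sub>F \<nu> in at_top. gs \<kappa>' \<preceq> s \<nu> - \<alpha> \<and> \<kappa> < \<nu>"
    using assms eventually_gt_at_top eventually_conj by blast
  then obtain \<nu> where \<nu>: "gs \<kappa>' \<preceq> s \<nu> - \<alpha>" "\<kappa> < \<nu>"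
    using eventually_happens' trivial_limit_at_top_linorder by blast
  then have "s \<nu> - s \<kappa> \<prec> s \<nu> - \<alpha>"
    using s_strict[OF \<kappa>'] s_gauge[of \<kappa> \<nu>] le_trans by blast
  then have "s \<kappa> - s \<nu> \<prec> s \<nu> - \<alpha>" by (simp add: minus_le_commute le_minus_commute)
  from add_approx[OF this] have "s \<kappa> - \<alpha> \<approx> s \<kappa> - s \<nu>" by simp
  then show ?thesis using s_gauge[OF \<nu>(2)] minus_le_commute le_minus_commute le_trans by blast
qed

text \<open>A pseudo-limit \<alpha> gives c = 1 and n = 1; any other \<alpha> gives n = 0 with
  \<open>c\<close> the eventual value. Closeness makes the same pair serve both sequences.\<close>

lemma linear_asymptotics:
  "\<exists>c n. c \<noteq> 0 \<and> (\<forall>\<^sub>F \<nu> in at_top. s \<nu> - \<alpha> \<approx> c * gs \<nu> ^ n) \<and>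
     (\<forall>\<^sub>F \<mu> in at_top. t \<mu> - \<alpha> \<approx> c * gt \<mu> ^ n)"
proof (cases "\<forall>\<kappa>. \<forall>\<nu>>\<kappa>. gs \<kappa> \<preceq> s \<nu> - \<alpha>")
  case True
  interpret sw: close_pseudo_convergent W t gt s gs by (rule swap)
  have s_ev: "\<forall>\<^sub>F \<nu> in at_top. gs \<kappa> \<preceq> s \<nu> - \<alpha>" for \<kappa>
    using eventually_gt_at_top[of \<kappa>] by eventually_elim (use True in blast)
  have t_ev: "\<forall>\<^sub>F \<mu> in at_top. gt \<kappa> \<preceq> t \<mu> - \<alpha>" for \<kappa>
  proof -
    obtain \<nu>0 \<mu>0 where *: "\<forall>\<mu>\<ge>\<mu>0. \<forall>\<nu>\<ge>\<nu>0. gt \<kappa> \<prec> t \<mu> - s \<nu>"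
      using sw.close[of \<kappa>] by blast
    obtain \<kappa>' where \<kappa>': "gt \<kappa> \<preceq> gs \<kappa>'" using t_le_s by blast
    have "\<forall>\<^sub>F \<nu> in at_top. gs \<kappa>' \<preceq> s \<nu> - \<alpha> \<and> \<nu>0 \<le> \<nu>"
      using s_ev eventually_ge_at_top eventually_conj by blast
    then obtain \<nu> where \<nu>: "gs \<kappa>' \<preceq> s \<nu> - \<alpha>" "\<nu>0 \<le> \<nu>"
      using eventually_happens' trivial_limit_at_top_linorder by blast
    have "gt \<kappa> \<preceq> t \<mu> - \<alpha>" if "\<mu> \<ge> \<mu>0" for \<mu>
    proof -
      \<comment> \<open>A late term of \<open>s\<close> links \<open>t \<mu>\<close> to
        \<alpha>.\<close>
      have "gt \<kappa> \<preceq> (t \<mu> - s \<nu>) + (s \<nu> - \<alpha>)"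
      proof (rule le_add)
        show "gt \<kappa> \<preceq> t \<mu> - s \<nu>" using * that \<nu>(2) lt_imp_le by blast
        show "gt \<kappa> \<preceq> s \<nu> - \<alpha>" using \<kappa>' \<nu>(1) by (rule le_trans)
      qed
      then show ?thesis by simp
    qed
    then show ?thesis unfolding eventually_at_top_linorder by blast
  qed
  show ?thesis
    using approx_limit[OF s_ev] sw.approx_limit[OF t_ev]
    by (intro exI[of _ 1] exI[of _ "1::nat"]) auto
next
  case False
  then obtain \<kappa> \<nu>1 where \<nu>1: "\<kappa> < \<nu>1" "s \<nu>1 - \<alpha> \<prec> gs \<kappa>" by blast
  \<comment> \<open>The value of \<open>c\<close> lies below the gauge at \<kappa>, hence below that
    of every later difference from \<open>s \<nu>1\<close>, so it persists.\<close>
  define c where "c = s \<nu>1 - \<alpha>"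
  have s_const: "s \<nu> - \<alpha> \<approx> c" if "\<nu> > \<nu>1" for \<nu>
  proof -
    have "c \<prec> s \<nu> - s \<nu>1"
      using \<nu>1(2) s_gauge[OF that] s_strict[OF \<nu>1(1)] le_trans lt_imp_le unfolding c_def by blast
    then show ?thesis unfolding c_def by (rule diff_approx)
  qed
  obtain \<nu>0 \<mu>0 where *: "\<forall>\<nu>\<ge>\<nu>0. \<forall>\<mu>\<ge>\<mu>0. gs \<kappa> \<prec> s \<nu> - t \<mu>"
    using close by blast
  obtain \<nu> where \<nu>: "\<nu> > max \<nu>0 \<nu>1" using gt_ex by blast
  have t_const: "t \<mu> - \<alpha> \<approx> c" if "\<mu> \<ge> \<mu>0" for \<mu>
  proof -
    have "\<nu>0 \<le> \<nu>" using \<nu> by (auto intro: less_imp_le)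
    then have "gs \<kappa> \<preceq> s \<nu> - t \<mu>" using * that lt_imp_le by blast
    \<comment> \<open>The value of \<open>gs \<kappa>\<close> separates the two:
      \<open>s \<nu> - \<alpha>\<close> has the smaller value of \<open>c\<close>.\<close>
    then have "s \<nu> - \<alpha> \<prec> t \<mu> - s \<nu>"
      using s_const[of \<nu>] \<nu> \<nu>1(2) le_trans le_minus_commute unfolding c_def
      by (metis max_less_iff_conj)
    from diff_approx[OF this] show ?thesis using s_const[of \<nu>] \<nu> le_trans
      by (metis max_less_iff_conj)
  qed
  have "c \<noteq> 0" using \<nu>1(2) lt_nonzero unfolding c_def by blast
  moreover have "\<forall>\<^sub>F \<nu> in at_top. s \<nu> - \<alpha> \<approx> c"
    using eventually_gt_at_top[of \<nu>1] by eventually_elim (rule s_const)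
  moreover have "\<forall>\<^sub>F \<mu> in at_top. t \<mu> - \<alpha> \<approx> c"
    using eventually_ge_at_top[of \<mu>0] by eventually_elim (rule t_const)
  ultimately show ?thesis by (intro exI[of _ c] exI[of _ "0::nat"]) auto
qed

text \<open>Over an algebraically closed field \<open>p\<close> splits into linear factors, and
  their monomial asymptotics multiply. The exponent counts the roots that are pseudo-limits.\<close>

lemma poly_asymptotics:
  assumes "p \<noteq> 0"
  shows "\<exists>c n. c \<noteq> 0 \<and> (\<forall>\<^sub>F \<nu> in at_top. poly p (s \<nu>) \<approx> c * gs \<nu> ^ n) \<and>
     (\<forall>\<^sub>F \<mu> in at_top. poly p (t \<mu>) \<approx> c * gt \<mu> ^ n)"
proof -
  have prod: "\<exists>c n. c \<noteq> 0 \<and>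
      (\<forall>\<^sub>F \<nu> in at_top. poly (\<Prod>x\<in>#A. [:- x, 1:]) (s \<nu>) \<approx> c * gs \<nu> ^ n) \<and>
      (\<forall>\<^sub>F \<mu> in at_top. poly (\<Prod>x\<in>#A. [:- x, 1:]) (t \<mu>) \<approx> c * gt \<mu> ^ n)" for A
  proof (induction A)
    case empty
    show ?case by (intro exI[of _ 1] exI[of _ "0::nat"]) auto
  next
    case (add \<alpha> A)
    let ?P = "\<Prod>x\<in>#A. [:- x, 1:]"
    obtain c n where c: "c \<noteq> 0" "\<forall>\<^sub>F \<nu> in at_top. poly ?P (s \<nu>) \<approx> c * gs \<nu> ^ n"
      "\<forall>\<^sub>F \<mu> in at_top. poly ?P (t \<mu>) \<approx> c * gt \<mu> ^ n" using add by blast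
    obtain d m where d: "d \<noteq> 0" "\<forall>\<^sub>F \<nu> in at_top. s \<nu> - \<alpha> \<approx> d * gs \<nu> ^ m"
      "\<forall>\<^sub>F \<mu> in at_top. t \<mu> - \<alpha> \<approx> d * gt \<mu> ^ m" using linear_asymptotics by blast
    have mult: "(x - \<alpha>) * y \<approx> d * c * z ^ (m + n)"
      if "x - \<alpha> \<approx> d * z ^ m" "y \<approx> c * z ^ n" for x y z
      using that le_mult[of "x - \<alpha>" "d * z ^ m" y "c * z ^ n"]
        le_mult[of "d * z ^ m" "x - \<alpha>" "c * z ^ n" y]
      by (simp add: power_add mult_ac)
    have eval: "poly (\<Prod>x\<in>#add_mset \<alpha> A. [:- x, 1:]) z = (z - \<alpha>) * poly ?P z" for z
      by (simp add: algebra_simps)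
    have "\<forall>\<^sub>F \<nu> in at_top. (s \<nu> - \<alpha>) * poly ?P (s \<nu>) \<approx> d * c * gs \<nu> ^ (m + n)"
      using d(2) c(2) by eventually_elim (rule mult)
    moreover have "\<forall>\<^sub>F \<mu> in at_top. (t \<mu> - \<alpha>) * poly ?P (t \<mu>) \<approx> d * c * gt \<mu> ^ (m + n)"
      using d(3) c(3) by eventually_elim (rule mult)
    moreover have "d * c \<noteq> 0" using c d by simp
    ultimately show ?case unfolding eval by blast
  qed
  obtain A where A: "p = Polynomial.smult (lead_coeff p) (\<Prod>x\<in>#A. [:- x, 1:])"
    using alg_closed_imp_factorization[OF assms] by blast
  let ?P = "\<Prod>x\<in>#A. [:- x, 1:]"
  obtain c n where c: "c \<noteq> 0" "\<forall>\<^sub>F \<nu> in at_top. poly ?P (s \<nu>) \<approx> c * gs \<nu> ^ n"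
    "\<forall>\<^sub>F \<mu> in at_top. poly ?P (t \<mu>) \<approx> c * gt \<mu> ^ n" using prod by blast
  define l where "l = lead_coeff p"
  have l: "l \<noteq> 0" using assms by (simp add: l_def)
  have p: "poly p z = l * poly ?P z" for z
    by (subst A) (simp add: l_def)
  show ?thesis
    unfolding p using c l mult_le_cancel_left[OF l]
    by (intro exI[of _ "l * c"] exI[of _ n]) (auto simp: mult.assoc)
qed

text \<open>After cancelling, a power of the gauge remains on one side. On the right, growth of the
  gauge helps, so a single index of \<open>s\<close> suffices; on the left it hurts, so each
  \<open>gt \<mu>\<close> is bounded by a late \<open>gs \<nu>\<close>.\<close>

lemma monomial_le_transfer:
  assumes "c \<noteq> 0" "d \<noteq> 0" "\<forall>\<^sub>F \<nu> in at_top. d * gs \<nu> ^ m \<preceq> c * gs \<nu> ^ n"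
  shows "\<forall>\<^sub>F \<mu> in at_top. d * gt \<mu> ^ m \<preceq> c * gt \<mu> ^ n"
proof (cases "m \<le> n")
  case True
  then obtain k where n: "n = m + k" using le_Suc_ex by blast
  have cancel: "d * z ^ m \<preceq> c * z ^ n \<longleftrightarrow> d \<preceq> c * z ^ k" if "z \<noteq> 0" for z
    using mult_le_cancel_left[of "z ^ m" d "c * z ^ k"] that by (simp add: n power_add mult_ac)
  obtain \<nu> where \<nu>: "d \<preceq> c * gs \<nu> ^ k"
    using eventually_happens'[OF trivial_limit_at_top_linorder assms(3)] cancel gs_nonzero by blast
  show ?thesis using eventually_gt_ge[of \<nu>]
  proof eventually_elim
    case (elim \<mu>)
    then have "c * gs \<nu> ^ k \<preceq> c * gt \<mu> ^ k" by (intro le_mult le_power) auto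
    then show ?case using \<nu> le_trans cancel gt_nonzero by blast
  qed
next
  case False
  then obtain k where m: "m = n + k" using le_Suc_ex nat_le_linear by blast
  have cancel: "d * z ^ m \<preceq> c * z ^ n \<longleftrightarrow> d * z ^ k \<preceq> c" if "z \<noteq> 0" for z
    using mult_le_cancel_left[of "z ^ n" "d * z ^ k" c] that by (simp add: m power_add mult_ac)
  have "d * gt \<mu> ^ m \<preceq> c * gt \<mu> ^ n" for \<mu>
  proof -
    have "\<forall>\<^sub>F \<nu> in at_top. d * gs \<nu> ^ m \<preceq> c * gs \<nu> ^ n \<and> gt \<mu> \<preceq> gs \<nu>"
      using assms(3) eventually_gs_ge by (rule eventually_conj)
    then obtain \<nu> where \<nu>: "d * gs \<nu> ^ k \<preceq> c" "gt \<mu> \<preceq> gs \<nu>"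
      using eventually_happens' trivial_limit_at_top_linorder cancel gs_nonzero by blast
    then have "d * gt \<mu> ^ k \<preceq> d * gs \<nu> ^ k" by (intro le_mult le_power) auto
    then show ?thesis using \<nu> le_trans cancel gt_nonzero by blast
  qed
  then show ?thesis by simp
qed

text \<open>Nonvanishing of \<open>q\<close> is part of the conclusion because
  \<open>0 \<preceq> 0\<close> holds, so divisibility alone does not rule out a pole.\<close>

lemma fraction_transfer:
  assumes "p \<noteq> 0" "q \<noteq> 0"
    and "\<forall>\<^sub>F \<nu> in at_top. poly q (s \<nu>) \<preceq> poly p (s \<nu>)"
  shows "\<forall>\<^sub>F \<mu> in at_top. poly q (t \<mu>) \<noteq> 0 \<and> poly q (t \<mu>) \<preceq> poly p (t \<mu>)"
proof -
  obtain c n where c: "c \<noteq> 0" "\<forall>\<^sub>F \<nu> in at_top. poly p (s \<nu>) \<approx> c * gs \<nu> ^ n"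
    "\<forall>\<^sub>F \<mu> in at_top. poly p (t \<mu>) \<approx> c * gt \<mu> ^ n" using poly_asymptotics[OF assms(1)] by blast
  obtain d m where d: "d \<noteq> 0" "\<forall>\<^sub>F \<nu> in at_top. poly q (s \<nu>) \<approx> d * gs \<nu> ^ m"
    "\<forall>\<^sub>F \<mu> in at_top. poly q (t \<mu>) \<approx> d * gt \<mu> ^ m" using poly_asymptotics[OF assms(2)] by blast
  have "\<forall>\<^sub>F \<nu> in at_top. d * gs \<nu> ^ m \<preceq> c * gs \<nu> ^ n"
    using assms(3) c(2) d(2) by eventually_elim (blast intro: le_trans)
  from monomial_le_transfer[OF c(1) d(1) this] c(3) d(3) show ?thesis
  proof eventually_elim
    case (elim \<mu>)
    have "d * gt \<mu> ^ m \<noteq> 0" using d(1) gt_nonzero by simp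
    then have "poly q (t \<mu>) \<noteq> 0" using elim by (metis zero_le_iff)
    then show ?case using elim le_trans by blast
  qed
qed

end

subsection \<open>Transfer to rational functions over the base field\<close>

text \<open>For nonzero \<open>x\<close> both sides say that y/x lies in \<open>V\<close>; for
  \<open>x = 0\<close> both force \<open>y = 0\<close>.\<close>

lemma valuation_le_iff:
  fixes v :: "'k::field \<Rightarrow> 'g::linordered_ab_group_add top"
  assumes "valuation_of V v"
  shows "v x \<le> v y \<longleftrightarrow> vle V x y"
proof -
  have v: "valuation v" and V: "V = {x. top.Value 0 \<le> v x}"
    using assms by (auto simp: valuation_of_def)
  have top: "v z = top.Top \<longleftrightarrow> z = 0" and mult: "v (z * w) = v z + v w" for z w
    using v by (auto simp: valuation_def)
  show ?thesis
  proof (cases "x = 0")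
    case True
    then show ?thesis
      using top[of x] top[of y] V by (cases "v y") (auto simp: vle_def intro: exI[of _ 0])
  next
    case False
    then obtain a where a: "v x = top.Value a" using top[of x] by (cases "v x") auto
    have vle: "vle V x y \<longleftrightarrow> top.Value 0 \<le> v (y / x)"
      using False unfolding vle_def V by (auto intro!: bexI[of _ "y / x"])
    have "v y = v x + v (y / x)" using mult[of x "y / x"] False by simp
    then show ?thesis unfolding vle a by (cases "v (y / x)") auto
  qed
qed

lemma poly_map_poly_to_ac: "poly (map_poly to_ac p) (to_ac a) = to_ac (poly p a)"
  by (induction p) (auto simp: map_poly_pCons)

text \<open>Since \<open>W\<close> has trace \<open>V\<close>, membership of a value of \<phi> in
  \<open>V\<close> is divisibility in \<open>W\<close> of numerator by denominator, to which
  \<open>fraction_transfer\<close> applies.\<close>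

lemma V_seq_subset:
  fixes V :: "'k::field set"
  assumes "close_pseudo_convergent W (\<lambda>\<nu>. to_ac (s \<nu>)) gs (\<lambda>\<nu>. to_ac (t \<nu>)) gt"
    and W: "\<And>x. to_ac x \<in> W \<longleftrightarrow> x \<in> V"
  shows "V_seq V s \<subseteq> V_seq V t"
proof
  interpret close_pseudo_convergent W "\<lambda>\<nu>. to_ac (s \<nu>)" gs "\<lambda>\<nu>. to_ac (t \<nu>)" gt by fact
  fix \<phi> assume \<phi>: "\<phi> \<in> V_seq V s"
  obtain p q where pq: "\<phi> = Fract p q" "q \<noteq> 0" by (cases \<phi>) auto
  show "\<phi> \<in> V_seq V t"
  proof (cases "p = 0")
    case True
    have "has_value_at \<phi> a 0" for a
      unfolding has_value_at_def using pq True
      by (intro exI[of _ 0] exI[of _ 1]) (simp add: fract_collapse)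
    moreover have "0 \<in> V" using W[of 0] by simp
    ultimately show ?thesis unfolding V_seq_def by (auto intro!: always_eventually)
  next
    case False
    let ?P = "map_poly to_ac p" and ?Q = "map_poly to_ac q"
    have nz: "?P \<noteq> 0" "?Q \<noteq> 0" using False pq by (auto simp: map_poly_eq_0_iff)
    have "\<forall>\<^sub>F \<nu> in at_top. \<exists>c\<in>V. has_value_at \<phi> (s \<nu>) c"
      using \<phi> by (simp add: V_seq_def)
    then have "\<forall>\<^sub>F \<nu> in at_top. poly ?Q (to_ac (s \<nu>)) \<preceq> poly ?P (to_ac (s \<nu>))"
    proof eventually_elim
      case (elim \<nu>)
      then obtain c p' q' where c: "c \<in> V" "\<phi> = Fract p' q'" "poly q' (s \<nu>) \<noteq> 0"
        "c = poly p' (s \<nu>) / poly q' (s \<nu>)" unfolding has_value_at_def by blast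
      then have "q' \<noteq> 0" by auto
      \<comment> \<open>The representation p'/q' may change with \<nu>; cross-multiplying gives p =
        q c at \<open>s \<nu>\<close> even if \<open>q\<close> vanishes there.\<close>
      then have "p * q' = p' * q" using c pq by (simp add: eq_fract)
      then have "poly p (s \<nu>) * poly q' (s \<nu>) = poly p' (s \<nu>) * poly q (s \<nu>)"
        unfolding poly_mult[symmetric] by simp
      then have "poly p (s \<nu>) * poly q' (s \<nu>) = (poly q (s \<nu>) * c) * poly q' (s \<nu>)"
        using c by simp
      then have "poly p (s \<nu>) = poly q (s \<nu>) * c" using c(3) by simp
      then show ?case using c(1) W[of c] unfolding vle_def poly_map_poly_to_ac by auto
    qed
    from fraction_transfer[OF nz this]
    have "\<forall>\<^sub>F \<mu> in at_top. \<exists>c\<in>V. has_value_at \<phi> (t \<mu>) c"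
    proof eventually_elim
      case (elim \<mu>)
      then have q: "poly q (t \<mu>) \<noteq> 0" by (simp add: poly_map_poly_to_ac)
      then have "poly p (t \<mu>) / poly q (t \<mu>) \<in> V"
        using elim by (simp add: poly_map_poly_to_ac le_iff_divide flip: W)
      then show ?case using q pq(1) unfolding has_value_at_def by blast
    qed
    then show ?thesis by (simp add: V_seq_def)
  qed
qed

section \<open>Necessity of both conditions, by linear test functions\<close>

lemma linear_mem_V_seq_iff:
  assumes "valuation_of V v" "x \<noteq> 0"
  shows "Fract [:- a, 1:] [:x:] \<in> V_seq V s \<longleftrightarrow> (\<forall>\<^sub>F \<nu> in at_top. v x \<le> v (s \<nu> - a))"
proof -
  have "(\<exists>c\<in>V. has_value_at (Fract [:- a, 1:] [:x:]) b c) \<longleftrightarrow> v x \<le> v (b - a)" for b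
  proof -
    have "has_value_at (Fract [:- a, 1:] [:x:]) b ((b - a) / x)"
      unfolding has_value_at_def using assms(2)
      by (intro exI[of _ "[:- a, 1:]"] exI[of _ "[:x:]"]) auto
    then have "(\<exists>c\<in>V. has_value_at (Fract [:- a, 1:] [:x:]) b c) \<longleftrightarrow> (b - a) / x \<in> V"
      using has_value_at_unique by metis
    also have "\<dots> \<longleftrightarrow> vle V x (b - a)"
      unfolding vle_def using assms(2) by (auto intro!: bexI[of _ "(b - a) / x"])
    finally show ?thesis by (simp add: valuation_le_iff[OF assms(1)])
  qed
  then show ?thesis by (simp add: V_seq_def)
qed

lemma valuation_diff_ge:
  assumes "valuation v" "c \<le> v x" "c \<le> v y"
  shows "c \<le> v (x - y)"
proof -
  have "min (v x) (v (- y)) \<le> v (x + - y)" using assms(1) unfolding valuation_def by blast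
  then show ?thesis using assms by (auto simp: valuation_uminus min_def split: if_splits)
qed

lemma valuation_minus_commute: "valuation v \<Longrightarrow> v (x - y) = v (y - x)"
  using valuation_uminus[of v "x - y"] by simp

lemma gauge_strict_mono:
  assumes "valuation v" "pseudo_convergent v s" "\<nu> < \<rho>"
  shows "gauge v s \<nu> < gauge v s \<rho>"
proof -
  obtain \<sigma> where "\<rho> < \<sigma>" using gt_ex by blast
  then show ?thesis
    using assms gauge_eq[OF assms] gauge_eq[OF assms(1,2), of \<rho> \<sigma>]
    by (auto simp: pseudo_convergent_def)
qed

lemma gauge_less_Top:
  assumes "valuation v" "pseudo_convergent v s"
  shows "gauge v s \<nu> < top.Top"
proof -
  obtain \<rho> where "\<nu> < \<rho>" using gt_ex by blast
  from gauge_strict_mono[OF assms this] show ?thesis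
    by (cases "gauge v s \<nu>") auto
qed

text \<open>Otherwise \<open>s \<rho> - s \<nu>\<close>, whose value is the gauge at \<nu>, would
  lie in the breadth ideal of \<open>t\<close>, hence in that of \<open>s\<close>, and exceed its
  own value.\<close>

lemma gauge_dominated:
  assumes "valuation v" "pseudo_convergent v s" "breadth_ideal v t \<subseteq> breadth_ideal v s"
  shows "\<exists>\<mu>. gauge v s \<nu> \<le> gauge v t \<mu>"
proof (rule ccontr)
  assume *: "\<nexists>\<mu>. gauge v s \<nu> \<le> gauge v t \<mu>"
  obtain \<rho> where \<rho>: "\<nu> < \<rho>" using gt_ex by blast
  have "s \<rho> - s \<nu> \<in> breadth_ideal v t"
    using * gauge_eq[OF assms(1,2) \<rho>] by (auto simp: breadth_ideal_def not_le)
  then have "gauge v s \<nu> < v (s \<rho> - s \<nu>)" using assms(3) by (auto simp: breadth_ideal_def)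
  then show False using gauge_eq[OF assms(1,2) \<rho>] by simp
qed

text \<open>If \<open>v x\<close> is at most the gauge of \<open>t\<close> at \<mu>, the test
  function (X - t\<mu>)/x lies in both rings. Late terms of \<open>s\<close> then differ by value at
  least \<open>v x\<close>, which contradicts that \<open>x\<close> is in the breadth ideal of
  \<open>s\<close>.\<close>

lemma breadth_ideal_mono:
  assumes V: "valuation_of V v" and s: "pseudo_convergent v s" and t: "pseudo_convergent v t"
    and sub: "V_seq V t \<subseteq> V_seq V s"
  shows "breadth_ideal v s \<subseteq> breadth_ideal v t"
proof (rule subsetI, rule ccontr)
  have v: "valuation v" using V by (simp add: valuation_of_def)
  fix x assume x: "x \<in> breadth_ideal v s" "x \<notin> breadth_ideal v t"
  then obtain \<mu> where \<mu>: "v x \<le> gauge v t \<mu>" by (auto simp: breadth_ideal_def not_less)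
  have "v x < top.Top" using \<mu> gauge_less_Top[OF v t] by (rule le_less_trans)
  moreover have "v 0 = top.Top" using v by (simp add: valuation_def)
  ultimately have "x \<noteq> 0" by auto
  note mem = linear_mem_V_seq_iff[OF V this, of "t \<mu>"]
  have "\<forall>\<^sub>F \<rho> in at_top. v x \<le> v (t \<rho> - t \<mu>)"
    using eventually_gt_at_top[of \<mu>] by eventually_elim (use \<mu> gauge_eq[OF v t] in simp)
  then have "Fract [:- t \<mu>, 1:] [:x:] \<in> V_seq V t" by (simp only: mem)
  then have "Fract [:- t \<mu>, 1:] [:x:] \<in> V_seq V s" using sub by (rule rev_subsetD)
  then have "\<forall>\<^sub>F \<nu> in at_top. v x \<le> v (s \<nu> - t \<mu>)" by (simp only: mem)
  then obtain \<nu> where \<nu>: "\<And>\<nu>'. \<nu>' \<ge> \<nu> \<Longrightarrow> v x \<le> v (s \<nu>' - t \<mu>)"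
    unfolding eventually_at_top_linorder by blast
  obtain \<nu>' where \<nu>': "\<nu> < \<nu>'" using gt_ex by blast
  have "v x \<le> v (s \<nu>' - s \<nu>)"
    using valuation_diff_ge[OF v \<nu>[of \<nu>'] \<nu>[of \<nu>]] \<nu>' by simp
  moreover have "gauge v s \<nu> < v x" using x(1) by (auto simp: breadth_ideal_def)
  ultimately show False using gauge_eq[OF v s \<nu>'] by (simp add: not_le[symmetric])
qed

text \<open>The test function (X - t\<kappa>')/x, with \<open>v x\<close> the gauge at \<kappa>',
  brings late terms of both sequences near the common centre \<open>t \<kappa>'\<close>.\<close>

lemma V_seq_subset_imp_close:
  assumes V: "valuation_of V v" and t: "pseudo_convergent v t"
    and sub: "V_seq V t \<subseteq> V_seq V s"
  shows "\<exists>\<nu>0 \<mu>0. \<forall>\<nu>\<ge>\<nu>0. \<forall>\<mu>\<ge>\<mu>0. gauge v t \<kappa> < v (s \<nu> - t \<mu>)"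
proof -
  have v: "valuation v" using V by (simp add: valuation_of_def)
  \<comment> \<open>Membership yields only a weak inequality; passing from \<kappa> to a later index
    makes it strict.\<close>
  obtain \<kappa>' where \<kappa>': "\<kappa> < \<kappa>'" using gt_ex by blast
  obtain \<rho> where \<rho>: "\<kappa>' < \<rho>" using gt_ex by blast
  define x where "x = t \<rho> - t \<kappa>'"
  have vx: "v x = gauge v t \<kappa>'" using gauge_eq[OF v t \<rho>] by (simp add: x_def)
  moreover have "v 0 = top.Top" using v by (simp add: valuation_def)
  ultimately have "x \<noteq> 0" using gauge_less_Top[OF v t, of \<kappa>'] by auto
  note mem = linear_mem_V_seq_iff[OF V this, of "t \<kappa>'"]
  have t_ge: "v x \<le> v (t \<mu> - t \<kappa>')" if "\<mu> > \<kappa>'" for \<mu>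
    using gauge_eq[OF v t that] vx by simp
  have "\<forall>\<^sub>F \<mu> in at_top. v x \<le> v (t \<mu> - t \<kappa>')"
    using eventually_gt_at_top[of \<kappa>'] by eventually_elim (rule t_ge)
  then have "Fract [:- t \<kappa>', 1:] [:x:] \<in> V_seq V t" by (simp only: mem)
  then have "Fract [:- t \<kappa>', 1:] [:x:] \<in> V_seq V s" using sub by (rule rev_subsetD)
  then have "\<forall>\<^sub>F \<nu> in at_top. v x \<le> v (s \<nu> - t \<kappa>')" by (simp only: mem)
  then obtain \<nu>0 where \<nu>0: "\<And>\<nu>. \<nu> \<ge> \<nu>0 \<Longrightarrow> v x \<le> v (s \<nu> - t \<kappa>')"
    unfolding eventually_at_top_linorder by blast
  have "gauge v t \<kappa> < v (s \<nu> - t \<mu>)" if "\<nu> \<ge> \<nu>0" "\<mu> \<ge> \<rho>" for \<nu> \<mu>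
  proof -
    have "\<mu> > \<kappa>'" using that \<rho> by simp
    then have "v x \<le> v (s \<nu> - t \<mu>)"
      using valuation_diff_ge[OF v \<nu>0[OF that(1)] t_ge[of \<mu>]] by simp
    then show ?thesis using gauge_strict_mono[OF v t \<kappa>'] vx by simp
  qed
  then show ?thesis by blast
qed

section \<open>Sufficiency, and the combination of both directions\<close>

lemma equivalent_if_close:
  fixes V :: "'k::field set" and s t :: "'l::{wellorder,no_top} \<Rightarrow> 'k"
  assumes V: "valuation_domain V" "valuation_of V v"
    and s: "pseudo_convergent v s" and t: "pseudo_convergent v t"
    and breadth: "breadth_ideal v s = breadth_ideal v t"
    and close: "\<And>\<kappa>. \<exists>\<nu>0 \<mu>0. \<forall>\<nu>\<ge>\<nu>0. \<forall>\<mu>\<ge>\<mu>0. gauge v t \<kappa> < v (s \<nu> - t \<mu>)"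
  shows "V_seq V s = V_seq V t"
proof -
  have v: "valuation v" using V(2) by (simp add: valuation_of_def)
  obtain W :: "'k alg_closure set" where W: "valuation_domain W" "\<And>x. to_ac x \<in> W \<longleftrightarrow> x \<in> V"
    using valuation_domain_extension[OF V(1)] by blast
  interpret W: valuation_domain_order W by unfold_locales (fact W(1))
  interpret V: valuation_domain_order V by unfold_locales (fact V(1))
  have le: "vle W (to_ac x) (to_ac y) \<longleftrightarrow> v x \<le> v y" for x y
  proof (cases "x = 0")
    case True
    then show ?thesis by (simp add: valuation_le_iff[OF V(2)])
  next
    case False
    then show ?thesis
      by (auto simp: valuation_le_iff[OF V(2)] W.le_iff_divide vle_def
          simp flip: W(2) intro!: bexI[of _ "y / x"])
  qed
  have ex: "\<exists>y. v y = gauge v r \<nu>" if "pseudo_convergent v r" for r and \<nu> :: 'l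
  proof -
    obtain \<rho> where "\<nu> < \<rho>" using gt_ex by blast
    then have "v (r \<rho> - r \<nu>) = gauge v r \<nu>" using gauge_eq[OF v that] by simp
    then show ?thesis ..
  qed
  obtain gs where gs: "\<And>\<nu>. v (gs \<nu>) = gauge v s \<nu>"
    using ex[OF s] by metis
  obtain gt where gt: "\<And>\<nu>. v (gt \<nu>) = gauge v t \<nu>"
    using ex[OF t] by metis
  have dom: "\<exists>\<mu>. gauge v s \<nu> \<le> gauge v t \<mu>" "\<exists>\<mu>. gauge v t \<nu> \<le> gauge v s \<mu>" for \<nu>
    using gauge_dominated[OF v s, of t] gauge_dominated[OF v t, of s] breadth by auto
  \<comment> \<open>The sequence \<open>t\<close> takes the first role because closeness is measured
    by its gauge; \<open>swap\<close> supplies the other inclusion.\<close>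
  interpret close_pseudo_convergent W "\<lambda>\<nu>. to_ac (t \<nu>)" "\<lambda>\<nu>. to_ac (gt \<nu>)"
    "\<lambda>\<nu>. to_ac (s \<nu>)" "\<lambda>\<nu>. to_ac (gs \<nu>)"
  proof (unfold_locales, unfold to_ac_diff[symmetric] le gs gt)
    fix \<kappa>
    show "\<exists>\<nu>0 \<mu>0. \<forall>\<nu>\<ge>\<nu>0. \<forall>\<mu>\<ge>\<mu>0. \<not> v (t \<nu> - s \<mu>) \<le> gauge v t \<kappa>"
      using close[of \<kappa>] valuation_minus_commute[OF v] unfolding not_le by metis
  qed (use dom gauge_eq[OF v s] gauge_eq[OF v t] gauge_strict_mono[OF v s] gauge_strict_mono[OF v t]
    in \<open>auto simp: not_le\<close>)
  show ?thesis
    using V_seq_subset[OF close_pseudo_convergent_axioms W(2)] V_seq_subset[OF swap W(2)] by blast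
qed

theorem proposition5p3:
  fixes V :: "'k::field set"
    and v :: "'k \<Rightarrow> 'g::linordered_ab_group_add top"
    and s t :: "'l::{wellorder,no_top} \<Rightarrow> 'k"
  assumes "valuation_domain V"
    and "valuation_of V v"
    and "pseudo_convergent v s"
    and "pseudo_convergent v t"
  shows "equivalent_seqs V s t \<longleftrightarrow>
    breadth_ideal v s = breadth_ideal v t \<and>
    (\<forall>\<kappa>. \<exists>\<nu>0 \<mu>0. \<forall>\<nu>\<ge>\<nu>0. \<forall>\<mu>\<ge>\<mu>0. \<forall>\<rho>>\<kappa>. v (s \<nu> - t \<mu>) > v (t \<rho> - t \<kappa>))"
proof -
  have v: "valuation v" using assms(2) by (simp add: valuation_of_def)
  \<comment> \<open>The value for \<rho> beyond \<kappa> is constantly the gauge, and such \<rho>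
    exist because the index set has no maximum.\<close>
  have "(\<forall>\<rho>>\<kappa>. v (s \<nu> - t \<mu>) > v (t \<rho> - t \<kappa>)) \<longleftrightarrow> gauge v t \<kappa> < v (s \<nu> - t \<mu>)" for \<kappa> \<nu> \<mu>
    using gauge_eq[OF v assms(4)] gt_ex[of \<kappa>] by metis
  then show ?thesis
    unfolding equivalent_seqs_def
    using equivalent_if_close[OF assms] breadth_ideal_mono[OF assms(2,3,4)]
      breadth_ideal_mono[OF assms(2,4,3)] V_seq_subset_imp_close[OF assms(2,4), of s]
    by (auto simp del: not_le)
qed

end
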